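(* Let $G$ be a profinite group such that the set $\{x\in G : x^3=1\}$ has positive Haar measure. Then the set $\{x\in G : x^3=1\}$ has non-empty interior in $G$.
   Context: Haar measure means the normalized Haar measure of $G$. *)

theory Defs
  imports "HOL-Analysis.Analysis" "HOL-Probability.Probability"
begin

text \<open>Groups are written additively (class group_add does not require
commutativity), so the cube x^3 of the paper is x + x + x and 1 is 0.\<close>

definition totally_disconnected_space :: "'a::topological_space itself \<Rightarrow> bool" where
  "totally_disconnected_space _ \<longleftrightarrow>
     (\<forall>x::'a. connected_component_set UNIV x = {x})"

definition profinite_group :: "'a::{topological_group_add, t2_space} itself \<Rightarrow> bool" where
  "profinite_group T \<longleftrightarrow> compact (UNIV::'a set) \<and> totally_disconnected_space T"

definition haar_measure :: "'a::topological_group_add measure \<Rightarrow> bool" where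
  "haar_measure M \<longleftrightarrow>
     sets M = sets borel \<and> prob_space M \<and>
     (\<forall>g A. A \<in> sets borel \<longrightarrow> emeasure M ((\<lambda>x. g + x) ` A) = emeasure M A) \<and>
     (\<forall>A \<in> sets borel. emeasure M A = (INF U \<in> {U. open U \<and> A \<subseteq> U}. emeasure M U)) \<and>
     (\<forall>U. open U \<longrightarrow> emeasure M U = (SUP K \<in> {K. compact K \<and> K \<subseteq> U}. emeasure M K))"

end

theory Submission
  imports Defs
begin

text \<open>Let \<open>X\<close> be the set of solutions of \<open>x\<^sup>3 = 1\<close>. By outer regularity there are an open normal
subgroup \<open>N\<close> and \<open>t \<in> X\<close> such that \<open>X\<close> fills almost all of \<open>N t\<close>. With \<open>\<sigma>\<close> the
conjugation by \<open>t\<close>, this says that \<open>n \<sigma>(n) \<sigma>\<^sup>2(n) = 1\<close> for almost all \<open>n \<in> N\<close>, and it remains to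
remove ``almost''. Fix any \<open>g \<in> N\<close>. If \<open>n\<close> and the products of \<open>\<sigma>\<^sup>i(n)\<close> and \<open>\<sigma>\<^sup>i(n)\<^sup>-\<^sup>1\<close> with \<open>g\<close> satisfy the
identity, a computation shows that the defect
\<open>w = g\<^sup>-\<^sup>1 \<sigma>\<^sup>2(g)\<^sup>-\<^sup>1 \<sigma>(g)\<^sup>-\<^sup>1\<close> equals the commutator of \<open>n\<close> with its conjugate by \<open>g\<close>.
So this commutator does not depend on the generic \<open>n\<close>. It follows first that \<open>w\<close> is
central in \<open>N\<close>, and then, since the commutator behaves quadratically in \<open>n\<close>, that \<open>w = 1\<close>.
The generic elements are chosen one at a time, each occurring exactly once in all the words under
consideration, so only unions of translates of one small set have to be avoided.\<close>

section \<open>Group words\<close>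

lemmas group_normalise = add.assoc minus_add diff_conv_add_uminus

lemma uminus_commute:
  fixes a b :: "'a::group_add"
  assumes "a + b = b + a"
  shows "- a + b = b + - a"
proof -
  have "- a + (a + b) + - a = - a + (b + a) + - a" by (simp only: assms)
  then show ?thesis by (simp add: group_normalise del: add_uminus_conv_diff)
qed

text \<open>Meant for \<open>a, b, c\<close> the orbit of \<open>x\<close> under
  \<open>\<sigma>\<close> and \<open>g, h, k\<close> that of \<open>g\<close>. The relations
  \<open>abc\<close> make \<open>a\<close>, \<open>b\<close>, \<open>c\<close> commute. Solving each
  of the others for \<open>- k\<close> writes \<open>w\<close> as a conjugate by \<open>g\<close>, a
  plain element and a conjugate by \<open>h\<close>. Comparing these expressions in pairs yields two
  formulas for \<open>C'\<close>, and inserting them into \<open>w1\<close> leaves a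
  commutator.\<close>

lemma commutator_of_conjugate_triple:
  fixes a b c g h k :: "'a::group_add"
  assumes abc: "a + b + c = 0" "- a + - b + - c = 0"
    and 1: "a + g + (b + h) + (c + k) = 0"
    and 2: "b + g + (c + h) + (a + k) = 0"
    and 3: "c + g + (a + h) + (b + k) = 0"
    and 5: "- b + g + (- c + h) + (- a + k) = 0"
    and 6: "- c + g + (- a + h) + (- b + k) = 0"
  shows "- g - k - h = (- g + a + g) - a - (- g + a + g) + a"
proof -
  define w where "w = - g + - k + - h"
  define A B C where ABC: "A = - g + a + g" "B = - g + b + g" "C = - g + c + g"
  define A' B' C' where ABC': "A' = h + a + - h" "B' = h + b + - h" "C' = h + c + - h"
  have c: "c = - b + - a" using abc(1) by (metis add_eq_0_iff minus_add)
  have comm: "a + b = b + a" using abc by (metis add.inverse_unique c minus_add minus_minus)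
  have comm': "a + (b + x) = b + (a + x)" for x using comm by (metis add.assoc)
  have comm2: "- a + b = b + - a" by (rule uminus_commute[OF comm])
  have comm2': "- a + (b + x) = b + (- a + x)" for x using comm2 by (metis add.assoc)
  have sums: "A' + B' = - C'" "C + B = - A" "B + C = - A" "B' + A' = - C'"
    by (simp_all add: ABC ABC' c group_normalise comm comm' comm2 comm2' del: add_uminus_conv_diff)
  have k: "- k = a + g + b + h + c" "- k = b + g + c + h + a" "- k = c + g + a + h + b"
     "- k = - b + g + - c + h + - a" "- k = - c + g + - a + h + - b"
    by (rule sym, simp only: eq_neg_iff_add_eq_0,
        use 1 2 3 5 6 in \<open>simp add: group_normalise del: add_uminus_conv_diff\<close>)+
  have w1: "w = A + b + C'" by (simp add: w_def k(1) ABC ABC' group_normalise del: add_uminus_conv_diff)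
  have w2: "w = B + c + A'" by (simp add: w_def k(2) ABC ABC' group_normalise del: add_uminus_conv_diff)
  have w3: "w = C + a + B'" by (simp add: w_def k(3) ABC ABC' group_normalise del: add_uminus_conv_diff)
  have w5: "w = - B + - c + - A'" by (simp add: w_def k(4) ABC ABC' group_normalise del: add_uminus_conv_diff)
  have w6: "w = - C + - a + - B'" by (simp add: w_def k(5) ABC ABC' group_normalise del: add_uminus_conv_diff)
  have "0 = w - w" by simp
  also have "\<dots> = B + c + (A' + B') + a + C"
    by (subst w2, subst w6) (simp add: group_normalise del: add_uminus_conv_diff)
  finally have "B + c + - C' + (a + C) = 0" using sums by (simp add: group_normalise del: add_uminus_conv_diff)
  then have "C' = (a + C) + (B + c)"
    by (metis add.assoc add_eq_0_iff add_minus_cancel minus_minus minus_unique)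
  also have "\<dots> = a + (C + B) + c" by (simp add: add.assoc)
  finally have C1: "C' = a + - A + c" using sums by simp
  have "0 = w - w" by simp
  also have "\<dots> = - B + - c + - (B' + A') + - a + - C"
    by (subst w5, subst w3) (simp add: group_normalise del: add_uminus_conv_diff)
  finally have "- (c + B) + C' + - (C + a) = 0" using sums by (simp add: group_normalise del: add_uminus_conv_diff)
  then have "C' = (c + B) + (C + a)"
    by (metis add.assoc add_eq_0_iff add_minus_cancel minus_minus minus_unique)
  also have "\<dots> = c + (B + C) + a" by (simp add: add.assoc)
  finally have swap: "a + - A + c = c + - A + a" using sums C1 by simp
  have "w = A + b + (c + - A + a)" unfolding w1 C1 swap ..
  also have "\<dots> = A + - a + - A + a"
    by (simp add: c group_normalise comm comm' comm2 comm2' del: add_uminus_conv_diff)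
  finally show ?thesis by (simp add: w_def ABC)
qed

text \<open>The relation \<open>x + x' = w + x' + x\<close> is quadratic in \<open>x\<close>.
  Expanding it at \<open>a + b\<close> and cancelling the terms at \<open>a\<close> and
  \<open>b\<close> leaves mixed commutators; a single \<open>w\<close> survives because two diagonal
  terms face only one \<open>w\<close> at \<open>a + b\<close>.\<close>

lemma commutation_polarised:
  fixes a b a' b' w :: "'a::group_add"
  assumes aa: "a + a' = w + a' + a" and bb: "b + b' = w + b' + b"
    and ab: "(a + b) + (a' + b') = w + (a' + b') + (a + b)"
    and cw: "w + a = a + w" "w + a' = a' + w" "w + b' = b' + w"
  shows "w + (- a' + b + a' - b) = - a + b' + a - b'"
proof -
  have "- a' + a = - a' + (a + a') - a'" by (simp add: group_normalise del: add_uminus_conv_diff)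
  also have "\<dots> = w + a - a'" unfolding aa cw by (simp add: group_normalise cw del: add_uminus_conv_diff)
  finally have 1: "- a' + a = w + a - a'" .
  have "- (w + b') + b = - (w + b') + (b + b') - b'" by (simp add: group_normalise del: add_uminus_conv_diff)
  also have "\<dots> = b - b'" unfolding bb by (simp add: group_normalise del: add_uminus_conv_diff)
  finally have 2: "b - b' = - w + - b' + b" unfolding cw by (simp add: group_normalise del: add_uminus_conv_diff)
  have "w + a - a' + b + a' = - a' + ((a + b) + (a' + b')) - b'"
    unfolding 1[symmetric] by (simp add: group_normalise del: add_uminus_conv_diff)
  also have "\<dots> = - a' + (w + a') + b' + a + (b - b')"
    unfolding ab by (simp add: group_normalise del: add_uminus_conv_diff)
  also have "\<dots> = w + b' + a - w - b' + b"
    unfolding 2 cw(2) by (simp add: group_normalise del: add_uminus_conv_diff)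
  also have "\<dots> = b' + (w + a) - w - b' + b" unfolding cw(3) by (simp add: group_normalise del: add_uminus_conv_diff)
  also have "\<dots> = b' + a - b' + b" unfolding cw(1) by (simp add: group_normalise del: add_uminus_conv_diff)
  finally have "a + (w - a' + b + a') = b' + a - b' + b"
    unfolding cw(1) by (simp add: group_normalise del: add_uminus_conv_diff)
  then have "- a + (a + (w - a' + b + a')) - b = - a + (b' + a - b' + b) - b" by simp
  then show ?thesis by (simp add: group_normalise del: add_uminus_conv_diff)
qed

text \<open>The commutator of \<open>a'\<close> with \<open>b + c\<close> is that with
  \<open>b\<close> followed by the \<open>b\<close>-conjugate of that with \<open>c\<close>.
  Polarising at \<open>b\<close>, \<open>c\<close> and \<open>b + c\<close> thus identifies the
  \<open>b\<close>-conjugate of \<open>P\<close> with the \<open>b'\<close>-conjugate of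
  \<open>w + P\<close>.\<close>

lemma commutator_twisted_conjugation:
  fixes a b c a' b' c' w :: "'a::group_add"
  assumes R: "a + a' = w + a' + a" "b + b' = w + b' + b" "c + c' = w + c' + c"
      "(a + b) + (a' + b') = w + (a' + b') + (a + b)"
      "(a + c) + (a' + c') = w + (a' + c') + (a + c)"
      "(b + c) + (b' + c') = w + (b' + c') + (b + c)"
      "(a + (b + c)) + (a' + (b' + c')) = w + (a' + (b' + c')) + (a + (b + c))"
    and cw: "\<And>x. x \<in> {a, a', b, b', c, c'} \<Longrightarrow> w + x = x + w"
    and P: "P = - a' + c + a' - c"
  shows "- (- b + b') + P + (- b + b') = w + P"
proof -
  define Q where "Q = - a' + b + a' - b"
  have cw': "w + a = a + w" "w + a' = a' + w" "w + b = b + w" "w + b' = b' + w" "w + c' = c' + w"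
    using cw by simp_all
  have bc': "w + (b' + c') = (b' + c') + w" using cw'(4,5) by (metis add.assoc)
  have Sb: "w + Q = - a + b' + a - b'"
    unfolding Q_def by (rule commutation_polarised[OF R(1,2,4) cw'(1,2,4)])
  have Sc: "w + P = - a + c' + a - c'"
    unfolding P by (rule commutation_polarised[OF R(1,3,5) cw'(1,2,5)])
  have Sbc: "w + (- a' + (b + c) + a' - (b + c)) = - a + (b' + c') + a - (b' + c')"
    by (rule commutation_polarised[OF R(1,6,7) cw'(1,2) bc'])
  have "w + (Q + (b + P - b)) = w + (- a' + (b + c) + a' - (b + c))"
    unfolding Q_def P by (simp add: group_normalise del: add_uminus_conv_diff)
  also have "\<dots> = (- a + b' + a - b') + (b' + (- a + c' + a - c') - b')"
    unfolding Sbc by (simp add: group_normalise del: add_uminus_conv_diff)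
  also have "\<dots> = (w + Q) + (b' + (w + P) - b')" unfolding Sb Sc ..
  finally have "b + P - b = b' + (w + P) - b'" by (simp only: add.assoc add_left_cancel)
  then have "- b' + (b + P - b) + b' = w + P"
    by (simp add: group_normalise del: add_uminus_conv_diff)
  then show ?thesis by (simp add: group_normalise del: add_uminus_conv_diff)
qed

section \<open>Cosets of almost exponent three\<close>

text \<open>The cube of \<open>x + t\<close> is
  \<open>x + \<sigma> x + \<sigma> (\<sigma> x)\<close>, so \<open>S\<close> is the solution set in
  the coset of \<open>t\<close>, shifted into \<open>N\<close>. Measure enters only through
  \<open>choice\<close>. By normality, \<open>u + v \<in> N\<close> keeps \<open>u + x + v\<close>
  and \<open>u - x + v\<close> inside \<open>N\<close>.\<close>

locale cubing_coset =
  fixes N S :: "'a::group_add set" and t :: 'a and \<sigma> :: "'a \<Rightarrow> 'a"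
  assumes add_closed: "\<And>x y. x \<in> N \<Longrightarrow> y \<in> N \<Longrightarrow> x + y \<in> N"
    and minus_closed: "\<And>x. x \<in> N \<Longrightarrow> - x \<in> N"
    and conj_closed: "\<And>g x. x \<in> N \<Longrightarrow> g + x - g \<in> N"
    and cube: "t + t + t = 0"
    and \<sigma>_def: "\<And>x. \<sigma> x = t + x - t"
    and mem_S_iff: "\<And>x. x \<in> S \<longleftrightarrow> x \<in> N \<and> x + \<sigma> x + \<sigma> (\<sigma> x) = 0"
    and choice: "\<And>L. length L \<le> 100 \<Longrightarrow> \<forall>(u, v)\<in>set L. u + v \<in> N \<Longrightarrow>
       \<exists>x\<in>N. \<forall>(u, v)\<in>set L. u + x + v \<in> S \<and> u - x + v \<in> S"
begin

lemma \<sigma>_add: "\<sigma> (x + y) = \<sigma> x + \<sigma> y"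
  by (simp add: \<sigma>_def group_normalise del: add_uminus_conv_diff)

lemma \<sigma>_minus: "\<sigma> (- x) = - \<sigma> x"
  by (simp add: \<sigma>_def group_normalise del: add_uminus_conv_diff)

lemma \<sigma>_cube: "\<sigma> (\<sigma> (\<sigma> x)) = x"
proof -
  have "\<sigma> (\<sigma> (\<sigma> x)) = (t + t + t) + x - (t + t + t)"
    by (simp add: \<sigma>_def group_normalise del: add_uminus_conv_diff)
  then show ?thesis by (simp add: cube)
qed

text \<open>Up to sign this is the word \<open>g + \<sigma> g + \<sigma> (\<sigma> g)\<close>
  conjugated by \<open>g\<close>; the cyclic order is the one that the word computation
  produces.\<close>

definition defect :: "'a \<Rightarrow> 'a" where
  "defect g = - g - \<sigma> (\<sigma> g) - \<sigma> g"

text \<open>Supplies the hypotheses of \<open>commutator_of_conjugate_triple\<close> for the orbit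
  of \<open>x\<close>.\<close>

definition generic :: "'a \<Rightarrow> 'a \<Rightarrow> bool" where
  "generic g x \<longleftrightarrow> x \<in> S \<and> - x \<in> S \<and>
     (\<forall>y\<in>{x, \<sigma> x, \<sigma> (\<sigma> x)}. y + g \<in> S \<and> - y + g \<in> S)"

lemma defect_eq_0_iff:
  assumes "g \<in> N"
  shows "defect g = 0 \<longleftrightarrow> g \<in> S"
proof -
  have "- defect g = \<sigma> g + \<sigma> (\<sigma> g) + g"
    by (simp add: defect_def group_normalise del: add_uminus_conv_diff)
  moreover have "\<sigma> g + \<sigma> (\<sigma> g) + g = - g + (g + \<sigma> g + \<sigma> (\<sigma> g)) + g"
    by (simp add: group_normalise del: add_uminus_conv_diff)
  ultimately have eq: "- defect g = - g + (g + \<sigma> g + \<sigma> (\<sigma> g)) + g" by simp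
  have "defect g = 0 \<longleftrightarrow> g + \<sigma> g + \<sigma> (\<sigma> g) = 0"
  proof
    assume "defect g = 0"
    then have "- g + (g + \<sigma> g + \<sigma> (\<sigma> g)) + g = 0" using eq by simp
    then have "g + (- g + (g + \<sigma> g + \<sigma> (\<sigma> g)) + g) + - g = 0" by simp
    then show "g + \<sigma> g + \<sigma> (\<sigma> g) = 0" by (simp add: group_normalise del: add_uminus_conv_diff)
  next
    assume "g + \<sigma> g + \<sigma> (\<sigma> g) = 0"
    then show "defect g = 0" using eq by simp
  qed
  then show ?thesis using \<open>g \<in> N\<close> by (simp add: mem_S_iff)
qed

lemma generic_commutator:
  assumes "generic g x"
  shows "defect g = (- g + x + g) - x - (- g + x + g) + x"
  unfolding defect_def
proof (rule commutator_of_conjugate_triple[where b = "\<sigma> x" and c = "\<sigma> (\<sigma> x)"])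
qed (use assms in \<open>simp_all add: generic_def mem_S_iff \<sigma>_add \<sigma>_minus \<sigma>_cube\<close>)

lemma generic_commute:
  assumes "generic g x" "g \<in> S"
  shows "x + (- g + x + g) = (- g + x + g) + x"
proof -
  have "defect g = 0" using assms(2) defect_eq_0_iff mem_S_iff by blast
  moreover define A where "A = - g + x + g"
  ultimately have "A - x - A + x = 0"
    using generic_commutator[OF assms(1)] by simp
  then have "A - x - A + x + (- x + A) = - x + A" by simp
  then have "A - x = - x + A" by (simp add: group_normalise del: add_uminus_conv_diff)
  then have "x + (A - x) + x = x + (- x + A) + x" by simp
  then have "x + A = A + x" by (simp add: group_normalise del: add_uminus_conv_diff)
  then show ?thesis by (simp add: A_def)
qed

text \<open>One condition \<^term>\<open>generic g (u + x + v)\<close> amounts to eight conditions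
\<open>u' \<plusminus> x + v' \<in> S\<close>, so twelve of them fit into the budget of 100 in the assumption \<open>choice\<close>.\<close>

lemma generic_choice:
  assumes "length L \<le> 12" "\<forall>(g, u, v)\<in>set L. g \<in> N \<and> u + v \<in> N"
  shows "\<exists>x\<in>N. \<forall>(g, u, v)\<in>set L. generic g (u + x + v)"
proof -
  \<comment> \<open>Each condition on \<open>y = u + x + v\<close> and its
    \<open>\<sigma>\<close>-images becomes a pair of outer summands. Conditions on
    \<open>- y\<close> reverse the pair to \<open>- v\<close>, \<open>- u\<close> and use the
    \<open>- x\<close> half of \<open>choice\<close>.\<close>
  define E where "E = (\<lambda>(g, u, v).
    [(u, v), (- v, - u), (u, v + g), (- v, - u + g),
     (t + u, v - t + g), (t - v, - u - t + g),
     (t + t + u, v - t - t + g), (t + t - v, - u - t - t + g)])"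
  have "length (concat (map E M)) = 8 * length M" for M
    by (induction M) (auto simp: E_def)
  then have "length (concat (map E L)) \<le> 100" using assms(1) by simp
  moreover have "\<forall>(u', v')\<in>set (E (g, u, v)). u' + v' \<in> N" if "g \<in> N" "u + v \<in> N" for g u v
  proof -
    have m: "- v - u \<in> N" using minus_closed[OF that(2)] by (simp add: minus_add)
    have c: "t + x - t + g \<in> N" "t + (t + x - t) - t + g \<in> N" if "x \<in> N" for x
      using that \<open>g \<in> N\<close> add_closed conj_closed by blast+
    show ?thesis
      using that m add_closed[OF that(2,1)] add_closed[OF m that(1)] c[OF that(2)] c[OF m]
      by (simp add: E_def group_normalise del: add_uminus_conv_diff)
  qed
  then have "\<forall>(u', v')\<in>set (concat (map E L)). u' + v' \<in> N"
    using assms(2) by fastforce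
  ultimately obtain x where x: "x \<in> N"
    "\<forall>(u', v')\<in>set (concat (map E L)). u' + x + v' \<in> S \<and> u' - x + v' \<in> S"
    using choice by blast
  have "generic g (u + x + v)" if "(g, u, v) \<in> set L" for g u v
  proof -
    have "\<forall>(u', v')\<in>set (E (g, u, v)). u' + x + v' \<in> S \<and> u' - x + v' \<in> S"
      using x(2) that by fastforce
    then show ?thesis
      by (simp add: E_def generic_def \<sigma>_def group_normalise del: add_uminus_conv_diff)
  qed
  then show ?thesis using x(1) by blast
qed

text \<open>For generic \<open>d\<close> and \<open>f\<close>, the element \<open>f\<close> is the \<open>d\<close>-conjugate of \<open>a = d + f - d\<close>; it commutes with
\<open>a\<close> and with the \<open>g\<close>-conjugate of \<open>a\<close>, whose commutator is the defect. Taking \<open>f = e\<close> and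
\<open>f = e + p\<close> reaches an arbitrary \<open>p\<close>.\<close>

lemma defect_central:
  assumes g: "g \<in> N" and p: "p \<in> N"
  shows "defect g + p = p + defect g"
proof -
  have "0 \<in> N" using add_closed[OF g minus_closed[OF g]] by simp
  \<comment> \<open>Both \<open>d\<close> and \<open>g - d\<close> lie in \<open>S\<close>, so
    \<open>generic_commute\<close> applies to each of them.\<close>
  then obtain d where d: "d \<in> N" "d \<in> S" "g - d \<in> S"
    using choice[of "[(0, 0), (g, 0)]"] g by auto
  have gd: "g - d \<in> N" using d(3) mem_S_iff by blast
  have dpd: "d + (p - d) \<in> N" using conj_closed[OF p, of d] by (simp add: group_normalise del: add_uminus_conv_diff)
  obtain e where e: "e \<in> N" and gen: "generic g (d + e + - d)" "generic (g - d) (d + e + - d)"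
      "generic d (d + e + - d)" "generic g (d + e + (p - d))" "generic (g - d) (d + e + (p - d))"
      "generic d (d + e + (p - d))"
    using generic_choice[of "[(g, d, - d), (g - d, d, - d), (d, d, - d),
      (g, d, p - d), (g - d, d, p - d), (d, d, p - d)]"] g d gd dpd \<open>0 \<in> N\<close> by auto
  have comm: "defect g + f = f + defect g"
    if "generic g (d + f - d)" "generic (g - d) (d + f - d)" "generic d (d + f - d)" for f
  proof -
    define a where "a = d + f - d"
    define a' where "a' = - g + a + g"
    have f: "f = - d + a + d" by (simp add: a_def group_normalise del: add_uminus_conv_diff)
    have fa: "f + a = a + f"
      using generic_commute[OF that(3)[folded a_def] d(2)] by (simp only: f[symmetric])
    have "a + (- (g - d) + a + (g - d)) = (- (g - d) + a + (g - d)) + a"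
      by (rule generic_commute[OF that(2)[folded a_def] d(3)])
    \<comment> \<open>Conjugation by \<open>d\<close> turns \<open>a\<close> into \<open>f\<close>
      and its \<open>(g - d)\<close>-conjugate into its \<open>g\<close>-conjugate
      \<open>a'\<close>.\<close>
    then have "- d + (a + (- (g - d) + a + (g - d))) + d = - d + ((- (g - d) + a + (g - d)) + a) + d"
      by simp
    then have "(- d + a + d) + a' = a' + (- d + a + d)"
      unfolding a'_def by (simp add: group_normalise del: add_uminus_conv_diff)
    then have fa': "f + a' = a' + f" by (simp only: f[symmetric])
    have neg: "f + - y = - y + f" if "f + y = y + f" for y
      by (rule uminus_commute[OF that[symmetric], symmetric])
    have dg: "defect g = a' + - a + - a' + a"
      using generic_commutator[OF that(1)[folded a_def]] unfolding a'_def by simp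
    have lcomm: "f + (y + z) = y + (f + z)" if "f + y = y + f" for y z
      using that by (simp add: add.assoc[symmetric])
    note comms = fa fa' neg[OF fa] neg[OF fa']
    show ?thesis unfolding dg
      by (simp add: add.assoc comms comms[THEN lcomm] del: add_uminus_conv_diff)
  qed
  have 1: "defect g + e = e + defect g" using comm[of e] gen by simp
  have 2: "defect g + (e + p) = (e + p) + defect g"
    using comm[of "e + p"] gen by (simp add: group_normalise del: add_uminus_conv_diff)
  show ?thesis using 1 2 by (metis add.assoc add_left_cancel)
qed

text \<open>Each variable is chosen after all others occurring with it in a word were fixed, so that
the new variable occurs exactly once; this is why the order is \<open>b'\<close>, \<open>a\<close>, \<open>c\<close>, \<open>b\<close>.
The map from \<open>b\<close> to \<open>- b + \<phi> b\<close> is a crossed homomorphism and each of its generic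
values conjugates \<open>P\<close> to \<open>w + P\<close>, so comparing \<open>b\<close>, \<open>b'\<close> and \<open>b + b'\<close> gives \<open>w = w + w\<close>.\<close>

lemma defect_zero:
  assumes g: "g \<in> N"
  shows "defect g = 0"
proof -
  define w where "w = defect g"
  define \<phi> where "\<phi> = (\<lambda>x. - g + x + g)"
  have \<phi>_add: "\<phi> (x + y) = \<phi> x + \<phi> y" for x y
    by (simp add: \<phi>_def group_normalise del: add_uminus_conv_diff)
  have \<phi>_closed: "\<phi> x \<in> N" if "x \<in> N" for x
    using conj_closed[OF that, of "- g"] by (simp add: \<phi>_def)
  have zero: "0 \<in> N" using add_closed[OF g minus_closed[OF g]] by simp
  have cw: "w + x = x + w" if "x \<in> N" for x
    unfolding w_def using defect_central[OF g that] .
  \<comment> \<open>Centrality of \<open>w\<close> brings the commutator formula into the shape that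
    was polarised above.\<close>
  have R: "x + \<phi> x = w + \<phi> x + x" if "generic g x" for x
  proof -
    have x: "x \<in> N" using that by (simp add: generic_def mem_S_iff)
    have "w = \<phi> x - x - \<phi> x + x" unfolding w_def \<phi>_def by (rule generic_commutator[OF that])
    then have "x + w - x + \<phi> x + x = x + \<phi> x"
      by (simp add: group_normalise del: add_uminus_conv_diff)
    then show ?thesis unfolding cw[OF x, symmetric] by (simp add: group_normalise del: add_uminus_conv_diff)
  qed
  have Y: "- (- b + \<phi> b) + P + (- b + \<phi> b) = w + P"
    if "generic g a" "generic g b" "generic g c" "generic g (a + b)" "generic g (a + c)"
      "generic g (b + c)" "generic g (a + (b + c))" "P = - \<phi> a + c + \<phi> a - c" for a b c P
  proof (rule commutator_twisted_conjugation[of a "\<phi> a" w b "\<phi> b" c "\<phi> c"])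
    show "w + x = x + w" if "x \<in> {a, \<phi> a, b, \<phi> b, c, \<phi> c}" for x
    proof (rule cw)
      have "a \<in> N" "b \<in> N" "c \<in> N" using \<open>generic g a\<close> \<open>generic g b\<close> \<open>generic g c\<close>
        by (simp_all add: generic_def mem_S_iff)
      then show "x \<in> N" using that \<phi>_closed by auto
    qed
    show "P = - \<phi> a + c + \<phi> a - c" by fact
  qed (use R[OF that(1)] R[OF that(2)] R[OF that(3)] R[OF that(4)] R[OF that(5)] R[OF that(6)]
      R[OF that(7)] in \<open>simp_all only: \<phi>_add\<close>)
  obtain b' where b': "b' \<in> N" "generic g b'"
    using generic_choice[of "[(g, 0, 0)]"] zero g by auto
  \<comment> \<open>Chosen so that \<open>\<phi> l = b'\<close>. Hence \<open>\<phi> a2\<close> is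
    the \<open>b'\<close>-conjugate of \<open>\<phi> a\<close>, and the \<open>b'\<close>-conjugate
    \<open>P2\<close> of \<open>P\<close> is again a commutator to which \<open>Y\<close> applies,
    with \<open>a2\<close> and \<open>c2\<close>.\<close>
  define l where "l = g + b' - g"
  have l: "l \<in> N" unfolding l_def by (rule conj_closed[OF b'(1)])
  obtain a where a: "a \<in> N" "generic g a" "generic g (l + a + - l)" "generic g (a + b')"
    using generic_choice[of "[(g, 0, 0), (g, l, - l), (g, 0, b')]"] zero g b' l by auto
  define a2 where "a2 = l + a + - l"
  have a2: "a2 \<in> N" "generic g a2" using a(3) by (simp_all add: a2_def generic_def mem_S_iff)
  have \<phi>a2: "\<phi> a2 = b' + \<phi> a - b'"
    by (simp add: \<phi>_def a2_def l_def group_normalise del: add_uminus_conv_diff)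
  obtain c where c: "c \<in> N" "generic g c" "generic g (a + c)" "generic g (b' + c)"
      "generic g (a + b' + c)" "generic g (b' + c + - b')" "generic g (a2 + b' + c + - b')"
    using generic_choice[of "[(g, 0, 0), (g, a, 0), (g, b', 0), (g, a + b', 0),
       (g, b', - b'), (g, a2 + b', - b')]"] zero g b' a a2 add_closed
    by (auto simp: group_normalise simp del: add_uminus_conv_diff)
  define c2 where "c2 = b' + c + - b'"
  have c2: "c2 \<in> N" "generic g c2" using c(6) by (simp_all add: c2_def generic_def mem_S_iff)
  obtain b where b: "b \<in> N" "generic g b" "generic g (a + b)" "generic g (b + c)"
      "generic g (a + b + c)" "generic g (b + b')" "generic g (a + b + b')"
      "generic g (b + (b' + c))" "generic g (a + b + (b' + c))"
      "generic g (a2 + b)" "generic g (b + c2)" "generic g (a2 + b + c2)"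
    using generic_choice[of "[(g, 0, 0), (g, a, 0), (g, 0, c), (g, a, c), (g, 0, b'), (g, a, b'),
       (g, 0, b' + c), (g, a, b' + c), (g, a2, 0), (g, 0, c2), (g, a2, c2)]"]
      zero g b' a a2 c c2 add_closed by auto
  define P where "P = - \<phi> a + c + \<phi> a - c"
  define P2 where "P2 = b' + P - b'"
  have P2: "P2 = - \<phi> a2 + c2 + \<phi> a2 - c2"
    by (simp add: P2_def P_def \<phi>a2 c2_def group_normalise del: add_uminus_conv_diff)
  have 1: "- (- b' + \<phi> b') + P + (- b' + \<phi> b') = w + P"
    using a b' c by (intro Y[of a _ c]) (simp_all add: P_def add.assoc)
  have 2: "- (- (b + b') + \<phi> (b + b')) + P + (- (b + b') + \<phi> (b + b')) = w + P"
    using a b c by (intro Y[of a _ c]) (simp_all add: P_def add.assoc)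
  have 3: "- (- b + \<phi> b) + P2 + (- b + \<phi> b) = w + P2"
    using a2 b c c2 by (intro Y[of a2 _ c2])
      (simp_all add: P2 add.assoc c2_def del: add_uminus_conv_diff)
  \<comment> \<open>Since \<open>- (b + b') + \<phi> (b + b') = - b' + (- b + \<phi> b) + \<phi>
    b'\<close>, conjugation passes through \<open>P2\<close> and collects one \<open>w\<close> from
    \<open>b\<close> and another from \<open>b'\<close>, whereas fact \<open>2\<close> yields only
    one.\<close>
  have "w + P = - \<phi> b' + (- (- b + \<phi> b) + P2 + (- b + \<phi> b)) + \<phi> b'"
    unfolding 2[symmetric] P2_def \<phi>_add by (simp add: group_normalise del: add_uminus_conv_diff)
  also have "\<dots> = - \<phi> b' + w + P2 + \<phi> b'" unfolding 3 by (simp add: add.assoc)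
  also have "- \<phi> b' + w = w - \<phi> b'"
    using cw[OF minus_closed[OF \<phi>_closed[OF b'(1)]]] by simp
  also have "w - \<phi> b' + P2 + \<phi> b' = w + (- (- b' + \<phi> b') + P + (- b' + \<phi> b'))"
    unfolding P2_def by (simp add: group_normalise del: add_uminus_conv_diff)
  also have "\<dots> = w + (w + P)" unfolding 1 ..
  finally have "w + P = w + (w + P)" .
  then have "0 + P = w + P" by simp
  then show ?thesis unfolding w_def by (metis add_right_cancel)
qed

lemma subset_S: "N \<subseteq> S"
  using defect_zero defect_eq_0_iff by blast

end

section \<open>Haar measure and open normal subgroups\<close>

definition open_normal_subgroup :: "'a::topological_group_add set \<Rightarrow> bool" where
  "open_normal_subgroup K \<longleftrightarrow> open K \<and> 0 \<in> K \<and> (\<forall>x\<in>K. \<forall>y\<in>K. x + y \<in> K) \<and>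
     (\<forall>x\<in>K. - x \<in> K) \<and> (\<forall>x\<in>K. \<forall>g. g + x - g \<in> K)"

definition left_coset :: "'a::plus set \<Rightarrow> 'a \<Rightarrow> 'a set" where
  "left_coset K x = (+) x ` K"

lemma mem_left_coset_iff: "y \<in> left_coset K x \<longleftrightarrow> - x + y \<in> K" for x y :: "'a::group_add"
proof
  assume "- x + y \<in> K"
  then have "x + (- x + y) \<in> left_coset K x"
    unfolding left_coset_def by (rule imageI)
  then show "y \<in> left_coset K x" by (simp add: add.assoc[symmetric])
qed (auto simp: left_coset_def add.assoc[symmetric])

lemma left_coset_eq_iff:
  assumes "open_normal_subgroup K"
  shows "left_coset K x = left_coset K y \<longleftrightarrow> - x + y \<in> K"
proof
  assume "left_coset K x = left_coset K y"
  moreover have "y \<in> left_coset K y"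
    using assms by (simp add: mem_left_coset_iff open_normal_subgroup_def)
  ultimately show "- x + y \<in> K" by (metis mem_left_coset_iff)
next
  assume *: "- x + y \<in> K"
  then have **: "- y + x \<in> K"
    using assms unfolding open_normal_subgroup_def by (metis minus_add minus_minus)
  have "- x + z \<in> K \<longleftrightarrow> - y + z \<in> K" for z
  proof
    assume "- x + z \<in> K"
    then have "(- y + x) + (- x + z) \<in> K"
      using assms ** unfolding open_normal_subgroup_def by blast
    then show "- y + z \<in> K" by (simp add: add.assoc)
  next
    assume "- y + z \<in> K"
    then have "(- x + y) + (- y + z) \<in> K"
      using assms * unfolding open_normal_subgroup_def by blast
    then show "- x + z \<in> K" by (simp add: add.assoc)
  qed
  then show "left_coset K x = left_coset K y" by (auto simp: mem_left_coset_iff)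
qed

lemma disjoint_left_cosets:
  assumes "open_normal_subgroup K"
  shows "disjoint (left_coset K ` C)"
proof (rule disjointI)
  fix a b assume "a \<in> left_coset K ` C" "b \<in> left_coset K ` C" "a \<noteq> b"
  then obtain x y where xy: "a = left_coset K x" "b = left_coset K y" by blast
  show "a \<inter> b = {}"
  proof (rule ccontr)
    assume "a \<inter> b \<noteq> {}"
    then obtain z where "- x + z \<in> K" "- y + z \<in> K" unfolding xy by (auto simp: mem_left_coset_iff)
    then have "left_coset K x = left_coset K z" "left_coset K y = left_coset K z"
      using assms by (simp_all add: left_coset_eq_iff)
    then show False using \<open>a \<noteq> b\<close> xy by simp
  qed
qed

lemma open_left_coset:
  assumes "open K"
  shows "open (left_coset K (x::'a::topological_group_add))"
proof -
  have "left_coset K x = (\<lambda>y. - x + y) -` K" by (auto simp: mem_left_coset_iff)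
  moreover have "open ((\<lambda>y. - x + y) -` K)"
    by (intro open_vimage assms continuous_intros)
  ultimately show ?thesis by simp
qed

text \<open>The complement is a union of open cosets.\<close>

lemma closed_left_coset:
  fixes K :: "'a::topological_group_add set"
  assumes "open_normal_subgroup K"
  shows "closed (left_coset K x)"
proof -
  have "0 \<in> K" "open K" using assms by (simp_all add: open_normal_subgroup_def)
  have "- left_coset K x = (\<Union>y\<in>- left_coset K x. left_coset K y)"
  proof (intro equalityI subsetI)
    fix y assume "y \<in> - left_coset K x"
    then show "y \<in> (\<Union>y\<in>- left_coset K x. left_coset K y)"
      using \<open>0 \<in> K\<close> by (auto simp: mem_left_coset_iff intro!: bexI[of _ y])
  next
    fix z assume "z \<in> (\<Union>y\<in>- left_coset K x. left_coset K y)"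
    then obtain y where y: "y \<notin> left_coset K x" "z \<in> left_coset K y" by blast
    then have "left_coset K y = left_coset K z"
      using left_coset_eq_iff[OF assms] mem_left_coset_iff by blast
    then show "z \<in> - left_coset K x"
      using y(1) left_coset_eq_iff[OF assms] mem_left_coset_iff \<open>0 \<in> K\<close>
      by (metis ComplI left_minus)
  qed
  then have "open (- left_coset K x)" using open_left_coset[OF \<open>open K\<close>] by (metis open_UN)
  then show ?thesis by (simp add: closed_def)
qed

text \<open>Cosets partition the group, so a finite subcover by cosets already contains all of
  them.\<close>

lemma finite_left_cosets:
  fixes K :: "'a::topological_group_add set"
  assumes "compact (UNIV::'a set)" "open_normal_subgroup K"
  shows "finite (left_coset K ` C)"
proof -
  have self: "x \<in> left_coset K x" for x
    using assms(2) by (simp add: mem_left_coset_iff open_normal_subgroup_def)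
  have "\<forall>B \<in> range (left_coset K). open B"
    using assms(2) open_left_coset by (auto simp: open_normal_subgroup_def)
  moreover have "UNIV \<subseteq> \<Union> (range (left_coset K))" using self by blast
  ultimately obtain F where F: "F \<subseteq> range (left_coset K)" "finite F" "UNIV \<subseteq> \<Union>F"
    using assms(1) by (meson compactE)
  have "left_coset K x \<in> F" for x
  proof -
    obtain B where B: "B \<in> F" "x \<in> B" using F(3) by blast
    then obtain y where y: "B = left_coset K y" using F(1) by blast
    then have "left_coset K y = left_coset K x"
      using B(2) assms(2) by (simp add: left_coset_eq_iff mem_left_coset_iff)
    then show ?thesis using B y by simp
  qed
  then show ?thesis using F(2) by (metis finite_subset image_subsetI)
qed

section \<open>Small open normal subgroups of a profinite group\<close>

text \<open>In a compact Hausdorff space quasi-components are components, so clopen sets separate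
  \<open>x\<close> from every other point; compactness of \<open>- U\<close> leaves finitely many of
  them to intersect.\<close>

lemma clopen_neighbourhood:
  fixes x :: "'a::t2_space"
  assumes comp: "compact (UNIV::'a set)" and td: "totally_disconnected_space TYPE('a)"
    and U: "open U" "x \<in> U"
  obtains C where "open C" "closed C" "x \<in> C" "C \<subseteq> U"
proof -
  have "compact_space (euclidean :: 'a topology)"
    using comp by (simp add: compact_space_def)
  moreover have "Hausdorff_space (euclidean :: 'a topology)"
    unfolding Hausdorff_space_def disjnt_def using hausdorff by fastforce
  ultimately have quasi: "quasi_component_of (euclidean :: 'a topology) x = connected_component_of euclidean x"
    by (intro quasi_eq_connected_component_of) blast
  have ex: "\<exists>T. open T \<and> closed T \<and> x \<in> T \<and> y \<notin> T" if "y \<noteq> x" for y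
  proof -
    have "y \<notin> connected_component_set UNIV x"
      using td that unfolding totally_disconnected_space_def by blast
    then have "\<not> connected_component_of euclidean x y"
      by (auto simp: connected_component_def connected_component_of_def)
    then show ?thesis
      using quasi by (metis quasi_component_of UNIV_I closed_closedin open_openin topspace_euclidean)
  qed
  define \<C> where "\<C> = {- T | T. open T \<and> closed T \<and> x \<in> T}"
  have "compact (- U)" using comp U(1) by (metis compact_Int_closed closed_Compl inf_top_left)
  moreover have "- U \<subseteq> \<Union>\<C>"
  proof
    fix y assume "y \<in> - U"
    then have "y \<noteq> x" using U(2) by auto
    then show "y \<in> \<Union>\<C>" using ex[of y] unfolding \<C>_def by blast
  qed
  moreover have "\<forall>B\<in>\<C>. open B" unfolding \<C>_def by auto
  ultimately obtain F where F: "F \<subseteq> \<C>" "finite F" "- U \<subseteq> \<Union>F" by (meson compactE)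
  have F': "open B \<and> closed B \<and> x \<notin> B" if "B \<in> F" for B
    using that F(1) unfolding \<C>_def by auto
  show ?thesis
  proof
    show "open (- \<Union>F)" using F(2) F' by (auto intro: closed_Union)
    show "closed (- \<Union>F)" using F' by (auto intro: open_Union)
    show "x \<in> - \<Union>F" using F' by auto
    show "- \<Union>F \<subseteq> U" using F(3) by auto
  qed
qed

lemma open_normal_subgroup_below:
  fixes U :: "'a::{topological_group_add, t2_space} set"
  assumes "profinite_group TYPE('a)" "open U" "0 \<in> U"
  obtains K where "open_normal_subgroup K" "K \<subseteq> U"
proof -
  have comp: "compact (UNIV::'a set)" and td: "totally_disconnected_space TYPE('a)"
    using assms(1) by (simp_all add: profinite_group_def)
  obtain C where C: "open C" "closed C" "0 \<in> C" "C \<subseteq> U"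
    using clopen_neighbourhood[OF comp td assms(2,3)] by blast
  \<comment> \<open>The elements that can be inserted anywhere in a sum without affecting membership
    in \<open>C\<close>. They form a normal subgroup, and inserting between two zeros shows
    \<open>K \<subseteq> C\<close>.\<close>
  define K where "K = {k. \<forall>x y. x + y \<in> C \<longleftrightarrow> x + k + y \<in> C}"
  have iff: "x + k + y \<in> C \<longleftrightarrow> x + y \<in> C" if "k \<in> K" for x y k
    using that unfolding K_def by blast
  \<comment> \<open>\<open>W\<close> is open because \<open>C\<close> is clopen; the tube lemma over
    all pairs \<open>(x, y)\<close> then gives a neighbourhood of \<open>0\<close> inside
    \<open>K\<close>.\<close>
  define W where "W = {p :: 'a \<times> 'a \<times> 'a. fst (snd p) + snd (snd p) \<in> C \<longleftrightarrow>
                        fst (snd p) + fst p + snd (snd p) \<in> C}"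
  have W: "W = ((\<lambda>p. fst (snd p) + snd (snd p)) -` C \<inter> (\<lambda>p. fst (snd p) + fst p + snd (snd p)) -` C)
      \<union> ((\<lambda>p. fst (snd p) + snd (snd p)) -` (- C) \<inter> (\<lambda>p. fst (snd p) + fst p + snd (snd p)) -` (- C))"
    unfolding W_def by blast
  have "open W"
    unfolding W using C(1,2)
    by (intro open_Un open_Int open_vimage open_Compl continuous_intros)
  moreover have "compact (UNIV :: ('a \<times> 'a) set)"
    using compact_Times[OF comp comp] by simp
  moreover have "{0} \<times> UNIV \<subseteq> W" by (auto simp: W_def)
  ultimately obtain V where V: "0 \<in> V" "open V" "V \<times> UNIV \<subseteq> W"
    by (metis Elementary_Topology.tube_lemma)
  have VK: "V \<subseteq> K"
  proof
    fix k assume "k \<in> V"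
    then have "(k, x, y) \<in> W" for x y using V(3) by blast
    then show "k \<in> K" by (simp add: W_def K_def)
  qed
  have zero: "0 \<in> K" by (simp add: K_def)
  have add: "k + l \<in> K" if "k \<in> K" "l \<in> K" for k l
  proof -
    have "x + (k + l) + y \<in> C \<longleftrightarrow> x + y \<in> C" for x y
      using iff[OF that(1), of x "l + y"] iff[OF that(2), of x y] by (simp add: add.assoc)
    then show ?thesis by (simp add: K_def)
  qed
  have neg: "- k \<in> K" if "k \<in> K" for k
  proof -
    have "x - k + y \<in> C \<longleftrightarrow> x + y \<in> C" for x y
      using iff[OF that, of "x - k" y] by simp
    then show ?thesis by (simp add: K_def)
  qed
  have conj: "g + k - g \<in> K" if "k \<in> K" for g k
  proof -
    have "x + (g + k - g) + y \<in> C \<longleftrightarrow> x + y \<in> C" for x y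
      using iff[OF that, of "x + g" "- g + y"]
      by (simp add: add.assoc diff_conv_add_uminus del: add_uminus_conv_diff)
    then show ?thesis by (simp add: K_def)
  qed
  have "open K"
  proof (subst open_subopen, intro ballI)
    fix k assume k: "k \<in> K"
    have "k \<in> left_coset V k" using V(1) by (simp add: mem_left_coset_iff)
    moreover have "left_coset V k \<subseteq> K" using VK add k by (auto simp: left_coset_def)
    ultimately show "\<exists>T. open T \<and> k \<in> T \<and> T \<subseteq> K" using open_left_coset[OF V(2)] by blast
  qed
  then have "open_normal_subgroup K"
    using zero add neg conj by (auto simp: open_normal_subgroup_def)
  moreover have "K \<subseteq> U" using iff[of _ 0 0] C by auto
  ultimately show ?thesis using that by blast
qed

text \<open>The tube lemma over the compact set \<open>C\<close> makes one neighbourhood of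
  \<open>0\<close> work for all points of \<open>C\<close>.\<close>

lemma left_cosets_in_open_superset:
  fixes C :: "'a::{topological_group_add, t2_space} set"
  assumes pro: "profinite_group TYPE('a)" and "closed C" "open U" "C \<subseteq> U"
  obtains K where "open_normal_subgroup K" "\<Union> (left_coset K ` C) \<subseteq> U"
proof -
  have "compact C"
    using assms(1,2) by (metis compact_Int_closed inf_top_left profinite_group_def)
  moreover define W where "W = (\<lambda>p :: 'a \<times> 'a. snd p + fst p) -` U"
  moreover have "open W"
    unfolding W_def using assms(3) by (intro open_vimage continuous_intros)
  moreover have "{0} \<times> C \<subseteq> W" using assms(4) by (auto simp: W_def)
  ultimately obtain V where V: "0 \<in> V" "open V" "V \<times> C \<subseteq> W"
    by (metis Elementary_Topology.tube_lemma)
  obtain K where K: "open_normal_subgroup K" "K \<subseteq> V"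
    using open_normal_subgroup_below[OF pro V(2,1)] by blast
  have "\<Union> (left_coset K ` C) \<subseteq> U" using K(2) V(3) by (fastforce simp: left_coset_def W_def)
  then show ?thesis using that K(1) by blast
qed

section \<open>Measuring closed sets by counting cosets\<close>

lemma haar_measure_left_coset:
  assumes "haar_measure M" "open K"
  shows "measure M (left_coset K x) = measure M K"
  using assms unfolding haar_measure_def left_coset_def measure_def by simp

lemma haar_measure_outer_regular:
  assumes "haar_measure M" "closed C" "measure M C < r"
  obtains U where "open U" "C \<subseteq> U" "measure M U < r"
proof -
  interpret prob_space M using assms(1) by (simp add: haar_measure_def)
  have "C \<in> sets borel" using assms(2) by simp
  then have "(INF U \<in> {U. open U \<and> C \<subseteq> U}. emeasure M U) = ennreal (measure M C)"
    using assms(1) unfolding haar_measure_def by (simp add: emeasure_eq_measure)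
  also have "\<dots> < ennreal r"
    using assms(3) by (simp add: ennreal_less_iff)
  finally obtain U where U: "open U" "C \<subseteq> U" "emeasure M U < ennreal r"
    by (auto simp: INF_less_iff)
  then have "measure M U < r" by (simp add: emeasure_eq_measure ennreal_less_iff)
  then show ?thesis using that U by blast
qed

lemma measure_Union_left_cosets:
  fixes M :: "'a::{topological_group_add, t2_space} measure"
  assumes "compact (UNIV::'a set)" "haar_measure M" "open_normal_subgroup K"
  shows "measure M (\<Union> (left_coset K ` C)) = real (card (left_coset K ` C)) * measure M K"
proof -
  interpret prob_space M using assms(2) by (simp add: haar_measure_def)
  have "open K" using assms(3) by (simp add: open_normal_subgroup_def)
  then have sets: "left_coset K x \<in> sets M" for x
    using assms(2) open_left_coset[OF \<open>open K\<close>] by (simp add: haar_measure_def)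
  have "measure M (\<Union>q\<in>left_coset K ` C. q) = (\<Sum>q\<in>left_coset K ` C. measure M q)"
    using finite_left_cosets[OF assms(1,3)] disjoint_left_cosets[OF assms(3)] sets
    by (intro finite_measure_finite_Union) (auto simp: disjoint_family_on_def disjoint_def)
  also have "\<dots> = (\<Sum>q\<in>left_coset K ` C. measure M K)"
    using haar_measure_left_coset[OF assms(2) \<open>open K\<close>] by (intro sum.cong) auto
  finally show ?thesis by simp
qed

text \<open>This supplies the right and inversion invariance of Haar measure on closed sets.\<close>

lemma measure_coset_preserving_image_le:
  fixes M :: "'a::{topological_group_add, t2_space} measure"
  assumes pro: "profinite_group TYPE('a)" and haar: "haar_measure M" and C: "closed C"
    and h: "\<And>K x. open_normal_subgroup K \<Longrightarrow> h ` left_coset K x \<subseteq> left_coset K (h x)"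
  shows "measure M (h ` C) \<le> measure M C"
proof (rule dense_ge)
  interpret prob_space M using haar by (simp add: haar_measure_def)
  have comp: "compact (UNIV::'a set)" using pro by (simp add: profinite_group_def)
  fix r assume "measure M C < r"
  then obtain U where U: "open U" "C \<subseteq> U" "measure M U < r"
    using haar_measure_outer_regular[OF haar C] by blast
  obtain K where K: "open_normal_subgroup K" "\<Union> (left_coset K ` C) \<subseteq> U"
    using left_cosets_in_open_superset[OF pro C U(1,2)] by blast
  have opK: "open K" and "0 \<in> K" using K(1) by (simp_all add: open_normal_subgroup_def)
  have eq: "left_coset K (h x) = left_coset K (h y)" if "left_coset K x = left_coset K y" for x y
  proof -
    have "y \<in> left_coset K x" using that \<open>0 \<in> K\<close> by (simp add: mem_left_coset_iff)
    then show ?thesis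
      using h[OF K(1), of x] K(1) by (auto simp: left_coset_eq_iff mem_left_coset_iff image_subset_iff)
  qed
  \<comment> \<open>By \<open>eq\<close> the choice of representative is harmless: \<open>h\<close>
    descends to a map of cosets, which cannot increase their number.\<close>
  define H where "H = (\<lambda>q. left_coset K (h (SOME x. left_coset K x = q)))"
  have H: "H (left_coset K x) = left_coset K (h x)" for x
    unfolding H_def by (rule eq, rule someI[of _ x], rule refl)
  have card: "card (left_coset K ` h ` C) \<le> card (left_coset K ` C)"
  proof -
    have "left_coset K ` h ` C = H ` left_coset K ` C" by (simp add: H image_image)
    then show ?thesis using finite_left_cosets[OF comp K(1)] by (metis card_image_le)
  qed
  have sets: "\<And>A. open A \<Longrightarrow> A \<in> sets M" using haar by (simp add: haar_measure_def)
  have "measure M (h ` C) \<le> measure M (\<Union> (left_coset K ` h ` C))"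
  proof (rule finite_measure_mono)
    show "h ` C \<subseteq> \<Union> (left_coset K ` h ` C)" using \<open>0 \<in> K\<close> by (auto simp: mem_left_coset_iff)
    show "\<Union> (left_coset K ` h ` C) \<in> sets M"
      using open_left_coset[OF opK] by (intro sets open_Union) auto
  qed
  also have "\<dots> \<le> measure M (\<Union> (left_coset K ` C))"
    unfolding measure_Union_left_cosets[OF comp haar K(1)]
    using card by (intro mult_right_mono) auto
  also have "\<dots> \<le> measure M U"
    using K(2) by (intro finite_measure_mono sets U(1))
  finally show "measure M (h ` C) \<le> r" using U(3) by simp
qed

text \<open>A substitute for Lebesgue density. If \<open>X\<close> had density at most
  \<open>1 - e\<close> in every coset, summing over the cosets that meet \<open>X\<close> would give
  at most \<open>(1 - e) * measure M U\<close>, and \<open>U\<close> is chosen to make this less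
  than \<open>measure M X\<close>.\<close>

lemma dense_left_coset:
  fixes M :: "'a::{topological_group_add, t2_space} measure"
  assumes pro: "profinite_group TYPE('a)" and haar: "haar_measure M" and X: "closed X"
    and pos: "measure M X > 0" and e: "0 < e" "e < 1"
  obtains K x where "open_normal_subgroup K"
    "measure M (X \<inter> left_coset K x) > (1 - e) * measure M K"
proof -
  interpret prob_space M using haar by (simp add: haar_measure_def)
  have comp: "compact (UNIV::'a set)" using pro by (simp add: profinite_group_def)
  have setso: "\<And>A. open A \<Longrightarrow> A \<in> sets M" and setsc: "\<And>A. closed A \<Longrightarrow> A \<in> sets M"
    using haar by (simp_all add: haar_measure_def)
  have "measure M X < measure M X / (1 - e)"
    using pos e by (simp add: field_simps)
  then obtain U where U: "open U" "X \<subseteq> U" "measure M U < measure M X / (1 - e)"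
    using haar_measure_outer_regular[OF haar X] by blast
  obtain K where K: "open_normal_subgroup K" "\<Union> (left_coset K ` X) \<subseteq> U"
    using left_cosets_in_open_superset[OF pro X U(1,2)] by blast
  have opK: "open K" and "0 \<in> K" using K(1) by (simp_all add: open_normal_subgroup_def)
  have "\<exists>x. measure M (X \<inter> left_coset K x) > (1 - e) * measure M K"
  proof (rule ccontr)
    assume "\<not> ?thesis"
    then have le: "measure M (X \<inter> left_coset K x) \<le> (1 - e) * measure M K" for x
      by (simp add: not_less)
    have "X = (\<Union>q\<in>left_coset K ` X. X \<inter> q)" using \<open>0 \<in> K\<close> by (auto simp: mem_left_coset_iff)
    then have "measure M X = measure M (\<Union>q\<in>left_coset K ` X. X \<inter> q)" by simp
    also have "\<dots> \<le> (\<Sum>q\<in>left_coset K ` X. measure M (X \<inter> q))"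
      using finite_left_cosets[OF comp K(1)] open_left_coset[OF opK] setso setsc[OF X]
      by (intro finite_measure_subadditive_finite) auto
    also have "\<dots> \<le> (\<Sum>q\<in>left_coset K ` X. (1 - e) * measure M K)"
      using le by (intro sum_mono) auto
    also have "\<dots> = (1 - e) * measure M (\<Union> (left_coset K ` X))"
      by (simp add: measure_Union_left_cosets[OF comp haar K(1)])
    also have "\<dots> \<le> (1 - e) * measure M U"
      using K(2) e by (intro mult_left_mono finite_measure_mono setso U(1)) auto
    also have "\<dots> < measure M X" using U(3) e by (simp add: field_simps)
    finally show False by simp
  qed
  then show ?thesis using that K(1) by blast
qed

text \<open>A union bound: two signs and at most 100 pairs give at most 200 maps, each bad on at
  most 1/400 of \<open>K\<close>, so at least half of \<open>K\<close> remains.\<close>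

lemma common_translate_point:
  fixes M :: "'a::{topological_group_add, t2_space} measure"
  assumes pro: "profinite_group TYPE('a)" and haar: "haar_measure M"
    and K: "open_normal_subgroup K" and S: "closed S" "S \<subseteq> K"
    and dense: "measure M S > (1 - 1/400) * measure M K"
    and L: "length L \<le> 100" "\<forall>(u, v)\<in>set L. u + v \<in> K"
  shows "\<exists>x\<in>K. \<forall>(u, v)\<in>set L. u + x + v \<in> S \<and> u - x + v \<in> S"
proof -
  interpret prob_space M using haar by (simp add: haar_measure_def)
  have setso: "\<And>A. open A \<Longrightarrow> A \<in> sets M" and setsc: "\<And>A. closed A \<Longrightarrow> A \<in> sets M"
    using haar by (simp_all add: haar_measure_def)
  have opK: "open K" and add: "\<And>x y. x \<in> K \<Longrightarrow> y \<in> K \<Longrightarrow> x + y \<in> K"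
    and neg: "\<And>x. x \<in> K \<Longrightarrow> - x \<in> K" and conj: "\<And>g x. x \<in> K \<Longrightarrow> g + x - g \<in> K"
    using K by (simp_all add: open_normal_subgroup_def)
  define h where "h = (\<lambda>(s, u, v) x :: 'a. u + (if s then x else - x) + v)"
  have h_coset: "h p ` left_coset K' x \<subseteq> left_coset K' (h p x)" if "open_normal_subgroup K'" for p K' x
  proof -
    obtain s u v where p: "p = (s, u, v)" by (cases p) auto
    have nrm: "- v + k - (- v) \<in> K'" "(- v + x) + - k - (- v + x) \<in> K'" if "k \<in> K'" for k
      using that \<open>open_normal_subgroup K'\<close> unfolding open_normal_subgroup_def by blast+
    show ?thesis
    proof (rule image_subsetI)
      fix y assume "y \<in> left_coset K' x"
      then obtain k where "k \<in> K'" "y = x + k" by (auto simp: left_coset_def)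
      then show "h p y \<in> left_coset K' (h p x)"
        using nrm[of k] by (simp add: p h_def mem_left_coset_iff
          group_normalise del: add_uminus_conv_diff)
    qed
  qed
  have cont: "continuous_on UNIV (h p)" for p
    by (cases p, cases "fst p") (auto simp: h_def intro!: continuous_intros)
  have surj: "h p ` (h p -` S) = S" for p
  proof -
    obtain s u v where p: "p = (s, u, v)" by (cases p) auto
    have "h p (if s then - u + y - v else v - y + u) = y" for y
      by (simp add: p h_def group_normalise del: add_uminus_conv_diff)
    then have "surj (h p)" by (rule surjI)
    then show ?thesis by (rule surj_image_vimage_eq)
  qed
  have closed: "closed (h p -` S)" for p
    by (rule closed_vimage[OF S(1) cont])
  have sub: "h (s, u, v) -` S \<subseteq> K" if "u + v \<in> K" for s u v
  proof
    fix x assume "x \<in> h (s, u, v) -` S"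
    then have "u + (if s then x else - x) + v \<in> K" using S(2) by (auto simp: h_def)
    then have "u + (if s then x else - x) + v + - (u + v) \<in> K" using that add neg by blast
    then have "- u + (u + (if s then x else - x) + v + - (u + v)) - (- u) \<in> K" by (rule conj)
    then have "(if s then x else - x) \<in> K"
      by (simp add: group_normalise del: add_uminus_conv_diff)
    then show "x \<in> K" using neg by (metis minus_minus)
  qed
  define I where "I = (UNIV :: bool set) \<times> set L"
  have "finite I" by (simp add: I_def)
  have "card I \<le> 200"
    using L(1) card_length[of L] by (simp add: I_def card_cartesian_product card_UNIV_bool)
  have bad: "measure M (K - h p -` S) \<le> measure M K / 400" if "p \<in> I" for p
  proof -
    have sub': "h p -` S \<subseteq> K" 
    proof -
      obtain s u v where p: "p = (s, u, v)" by (cases p) auto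
      then have "u + v \<in> K" using that L(2) by (auto simp: I_def)
      then show ?thesis unfolding p by (rule sub)
    qed
    \<comment> \<open>The image of the preimage is \<open>S\<close>, so the inequality for images
      bounds the preimage from below.\<close>
    have "measure M S \<le> measure M (h p -` S)"
      using measure_coset_preserving_image_le[OF pro haar closed h_coset, of p p] surj by simp
    moreover have "measure M (K - h p -` S) = measure M K - measure M (h p -` S)"
      using sub' by (intro finite_measure_Diff setso setsc opK closed)
    ultimately show ?thesis using dense by simp
  qed
  have posK: "measure M K > 0"
  proof -
    have "measure M S \<le> measure M K" using S(2) opK by (intro finite_measure_mono setso)
    then show ?thesis using dense by simp
  qed
  have "\<not> K \<subseteq> (\<Union>p\<in>I. K - h p -` S)"
  proof
    assume "K \<subseteq> (\<Union>p\<in>I. K - h p -` S)"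
    then have "measure M K \<le> measure M (\<Union>p\<in>I. K - h p -` S)"
      using \<open>finite I\<close> closed opK by (intro finite_measure_mono sets.finite_UN sets.Diff setso setsc) auto
    also have "\<dots> \<le> (\<Sum>p\<in>I. measure M (K - h p -` S))"
      using \<open>finite I\<close> closed opK setso setsc by (intro finite_measure_subadditive_finite) auto
    also have "\<dots> \<le> real (card I) * (measure M K / 400)"
      using bad by (intro sum_bounded_above) auto
    also have "\<dots> \<le> 200 * (measure M K / 400)"
      using \<open>card I \<le> 200\<close> by (intro mult_right_mono) auto
    finally show False using posK by simp
  qed
  then obtain x where x: "x \<in> K" "\<And>p. p \<in> I \<Longrightarrow> h p x \<in> S" by blast
  have "u + x + v \<in> S \<and> u - x + v \<in> S" if "(u, v) \<in> set L" for u v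
    using x(2)[of "(True, u, v)"] x(2)[of "(False, u, v)"] that by (simp add: I_def h_def)
  then show ?thesis using x(1) by blast
qed

section \<open>From a coset almost filled by solutions to one consisting of solutions\<close>

theorem theorem3p5:
  fixes M :: "'a::{topological_group_add, t2_space} measure"
  assumes "profinite_group TYPE('a)"
    and "haar_measure M"
    and "emeasure M {x::'a. x + x + x = 0} > 0"
  shows "interior {x::'a. x + x + x = 0} \<noteq> {}"
proof -
  interpret prob_space M using assms(2) by (simp add: haar_measure_def)
  define X where "X = {x::'a. x + x + x = 0}"
  have X: "closed X"
    unfolding X_def by (intro closed_Collect_eq continuous_intros)
  have "measure M X > 0"
    using assms(3) unfolding X_def[symmetric] by (simp add: emeasure_eq_measure)
  then obtain K x where K: "open_normal_subgroup K"
    and x: "measure M (X \<inter> left_coset K x) > (1 - 1/400) * measure M K"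
    using dense_left_coset[OF assms(1,2) X, of "1/400"] by auto
  have "X \<inter> left_coset K x \<noteq> {}"
  proof
    assume "X \<inter> left_coset K x = {}"
    then show False using x measure_nonneg[of M K] by simp
  qed
  then obtain t where t: "t \<in> X" "t \<in> left_coset K x" by blast
  then have eq: "left_coset K x = left_coset K t"
    using left_coset_eq_iff[OF K] mem_left_coset_iff by blast
  have opK: "open K" and zero: "0 \<in> K"
    and add: "\<And>x y. x \<in> K \<Longrightarrow> y \<in> K \<Longrightarrow> x + y \<in> K"
    and neg: "\<And>x. x \<in> K \<Longrightarrow> - x \<in> K" and conj: "\<And>g x. x \<in> K \<Longrightarrow> g + x - g \<in> K"
    using K by (simp_all add: open_normal_subgroup_def)
  define S where "S = (\<lambda>n. n + t) -` (X \<inter> left_coset K t)"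
  define \<sigma> where "\<sigma> = (\<lambda>x. t + x - t)"
  \<comment> \<open>By normality the left coset of \<open>t\<close> is also its right coset.\<close>
  have coset: "n + t \<in> left_coset K t \<longleftrightarrow> n \<in> K" for n
    using conj[of n "- t"] conj[of "- t + n + t" t]
    by (auto simp: mem_left_coset_iff group_normalise simp del: add_uminus_conv_diff)
  have closedS: "closed S"
    unfolding S_def
    by (intro closed_vimage closed_Int X closed_left_coset K continuous_intros)
  have SK: "S \<subseteq> K" using coset by (auto simp: S_def)
  have "(\<lambda>n. n + t) ` S = X \<inter> left_coset K t"
    unfolding S_def by (rule surj_image_vimage_eq, rule surjI[of _ "\<lambda>y. y - t"]) simp
  moreover have "(\<lambda>n. n + t) ` left_coset K' y \<subseteq> left_coset K' (y + t)"
    if "open_normal_subgroup K'" for K' y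
  proof (rule image_subsetI)
    fix z assume "z \<in> left_coset K' y"
    then have "- t + (- y + z) - - t \<in> K'"
      using that unfolding open_normal_subgroup_def mem_left_coset_iff by blast
    then show "z + t \<in> left_coset K' (y + t)"
      by (simp add: mem_left_coset_iff group_normalise del: add_uminus_conv_diff)
  qed
  ultimately have "measure M (X \<inter> left_coset K t) \<le> measure M S"
    using measure_coset_preserving_image_le[OF assms(1,2) closedS, of "\<lambda>n. n + t"] by simp
  then have dense: "measure M S > (1 - 1/400) * measure M K" using x eq by simp
  have t3: "t + t + t = 0" using t(1) by (simp add: X_def)
  \<comment> \<open>The twisted word expands to \<open>(n + t) + (n + t) + (n - t - t)\<close>; this
    identity turns it into the cube of \<open>n + t\<close>.\<close>
  have mt: "- t + - t = t"
    using t3 by (metis add.assoc add_eq_0_iff minus_add minus_minus)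
  interpret cubing_coset K S t \<sigma>
  proof
    show "n \<in> S \<longleftrightarrow> n \<in> K \<and> n + \<sigma> n + \<sigma> (\<sigma> n) = 0" for n
    proof -
      have "n + \<sigma> n + \<sigma> (\<sigma> n) = n + t + (n + t) + (n + (- t + - t))"
        by (simp add: \<sigma>_def group_normalise del: add_uminus_conv_diff)
      then show ?thesis unfolding mt S_def using coset by (auto simp: X_def)
    qed
    show "\<exists>x\<in>K. \<forall>(u, v)\<in>set L. u + x + v \<in> S \<and> u - x + v \<in> S"
      if "length L \<le> 100" "\<forall>(u, v)\<in>set L. u + v \<in> K" for L
      using common_translate_point[OF assms(1,2) K closedS SK dense that] .
  qed (use add neg conj t3 in \<open>simp_all add: \<sigma>_def\<close>)
  have "left_coset K t \<subseteq> X"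
  proof
    fix y assume "y \<in> left_coset K t"
    then have "y - t \<in> S" using coset[of "y - t"] subset_S by auto
    then show "y \<in> X" by (simp add: S_def)
  qed
  moreover have "t \<in> left_coset K t" using zero by (simp add: mem_left_coset_iff)
  ultimately have "t \<in> interior X" using open_left_coset[OF opK] by (blast intro: interiorI)
  then show ?thesis unfolding X_def by blast
qed

end
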